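(* Let $r\ge 1$ and let $F^{[r]}_n=F^{[r]}_n(x_1,\dots,x_r)$ be the $r$-Fibonacci polynomials. For every integer $n\ge 2r-2$, let $A_n$ be the $r\times r$ matrix with entries $(A_n)_{i,j}=F^{[r]}_{n-r+1+j-i}$ for $1\le i,j\le r$ (so its first row is $(F^{[r]}_{n-r+1},\dots,F^{[r]}_n)$ and its last row is $(F^{[r]}_{n-2r+2},\dots,F^{[r]}_{n-r+1})$). Then $$\det A_n=(-1)^{n(r+1)}x_r^{\,n-2r+2}.$$
   Context: For an integer $r\ge 1$, the $r$-Fibonacci polynomial $F^{[r]}_n(x_1,\dots,x_r)$ is defined by $F^{[r]}_n=0$ for $0\le n<r-1$, $F^{[r]}_{r-1}=1$, and $F^{[r]}_n=\sum_{i=1}^r x_iF^{[r]}_{n-i}$ for $n\ge r$. *)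

theory Defs
  imports "HOL-Library.Poly_Mapping" "Jordan_Normal_Form.Determinant"
begin

text \<open>
  Polynomials with integer coefficients in the indeterminates \<open>x\<^sub>0, x\<^sub>1, x\<^sub>2, \<dots>\<close>:
  a monomial is a finitely supported exponent function on indices, a polynomial a finitely
  supported coefficient function on monomials. The ring \<open>\<int>[x\<^sub>1, \<dots>, x\<^sub>r]\<close> consists of
  the elements in which only the indices \<open>1, \<dots>, r\<close> occur.
\<close>

type_synonym int_mpoly = "(nat \<Rightarrow>\<^sub>0 nat) \<Rightarrow>\<^sub>0 int"

definition X :: "nat \<Rightarrow> int_mpoly" where
  "X i = Poly_Mapping.single (Poly_Mapping.single i 1) 1"

text \<open>
  In the recursive branch \<open>n \<ge> r\<close>, so \<open>n - i\<close> is never truncated.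
  Only \<open>r \<ge> 1\<close> is meaningful.
\<close>

function r_fib :: "nat \<Rightarrow> nat \<Rightarrow> int_mpoly" where
  "r_fib r n =
     (if n < r - 1 then 0
      else if n = r - 1 then 1
      else (\<Sum>i = 1..r. X i * r_fib r (n - i)))"
  by pat_completeness auto
termination
  by (relation "measure snd") auto

declare r_fib.simps [simp del]

text \<open>
  Rows and columns are numbered from \<open>0\<close>; the shift does not affect \<open>j - i\<close>.
  The index is \<open>n - r + 1 + j - i\<close>, arranged so that the subtraction is
  not truncated when \<open>r \<ge> 1\<close>, \<open>n \<ge> 2 * r - 2\<close> and \<open>i, j < r\<close>.
\<close>

definition r_fib_mat :: "nat \<Rightarrow> nat \<Rightarrow> int_mpoly mat" where
  "r_fib_mat r n = mat r r (\<lambda>(i, j). r_fib r ((n + 1 + j) - (r + i)))"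

end

theory Submission imports Defs begin

text \<open>
  By the recurrence, passing from \<open>n\<close> to \<open>n + 1\<close> multiplies the matrix on the right by a
  companion matrix of determinant \<open>(- 1) ^ (r + 1) * X r\<close>. The initial matrix at
  \<open>n = 2 * r - 2\<close> is upper unitriangular.
\<close>

text \<open>The last column reads \<open>c r\<close>, ..., \<open>c 1\<close> downwards, because the
  indices in a row of \<open>r_fib_mat\<close> increase to the right, while the recurrence pairs
  \<open>X i\<close> with the term i places back.\<close>

definition companion :: "nat \<Rightarrow> (nat \<Rightarrow> 'a) \<Rightarrow> 'a :: comm_ring_1 mat" where
  "companion r c = mat r r (\<lambda>(i, j). if j = r - 1 then c (r - i) else if i = j + 1 then 1 else 0)"

lemma companion_carrier [simp]: "companion r c \<in> carrier_mat r r"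
  by (simp add: companion_def)

text \<open>Expansion along row 0, where only the last column can contribute; its cofactor sign is
  (-1)^m with \<open>r = Suc m\<close>, which agrees with (-1)^(r + 1).\<close>

lemma det_companion:
  assumes "r \<ge> 1"
  shows "det (companion r c) = (- 1) ^ (r + 1) * c r"
proof -
  obtain m where r: "r = Suc m"
    using assms by (cases r) auto
  let ?C = "companion r c"
  \<comment> \<open>Deleting row 0 and the last column moves the subdiagonal ones onto the
    diagonal.\<close>
  have minor: "mat_delete ?C 0 m = 1\<^sub>m m"
    by (rule eq_matI) (auto simp: mat_delete_def companion_def r)
  have "det ?C = (\<Sum>j<r. ?C $$ (0, j) * cofactor ?C 0 j)"
    by (rule laplace_expansion_row) (simp_all add: r)
  also have "\<dots> = ?C $$ (0, m) * cofactor ?C 0 m"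
    by (subst sum.remove[of _ m]) (auto simp: r companion_def intro!: sum.neutral)
  also have "\<dots> = (- 1) ^ (r + 1) * c r"
    unfolding cofactor_def minor by (simp add: companion_def r)
  finally show ?thesis .
qed

lemma r_fib_mat_carrier [simp]: "r_fib_mat r n \<in> carrier_mat r r"
  by (simp add: r_fib_mat_def)

lemma r_fib_less: "n < r - 1 \<Longrightarrow> r_fib r n = 0"
  by (subst r_fib.simps) simp

lemma r_fib_initial: "r_fib r (r - 1) = 1"
  by (subst r_fib.simps) simp

lemma r_fib_rec: "r \<ge> 1 \<Longrightarrow> n \<ge> r \<Longrightarrow> r_fib r n = (\<Sum>i = 1..r. X i * r_fib r (n - i))"
  by (subst r_fib.simps) simp

text \<open>Here the entry at (i, j) has index r - 1 + j - i, so it is an initial zero below the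
  diagonal and the initial 1 on it.\<close>

lemma det_r_fib_mat_initial:
  assumes "r \<ge> 1"
  shows "det (r_fib_mat r (2 * r - 2)) = 1"
proof -
  let ?A = "r_fib_mat r (2 * r - 2)"
  have "upper_triangular ?A"
    using assms by (auto simp: upper_triangular_def r_fib_mat_def intro!: r_fib_less)
  moreover have "?A $$ (i, i) = 1" if "i < r" for i
  proof -
    have "2 * r - 2 + 1 + i - (r + i) = r - 1"
      using assms by simp
    then show ?thesis
      using that by (simp only: r_fib_mat_def index_mat split_conv r_fib_initial)
  qed
  then have "diag_mat ?A = replicate r 1"
    by (intro nth_equalityI) (simp_all add: diag_mat_def r_fib_mat_def)
  ultimately show ?thesis
    by (simp add: det_upper_triangular[OF _ r_fib_mat_carrier])
qed

text \<open>Raising n by one shifts the columns one place to the left; only the new last column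
  needs the recurrence.\<close>

lemma r_fib_mat_Suc:
  assumes "r \<ge> 1" and "n \<ge> 2 * r - 2"
  shows "r_fib_mat r (Suc n) = r_fib_mat r n * companion r X"
proof (rule eq_matI)
  fix i j
  assume "i < dim_row (r_fib_mat r n * companion r X)"
    and "j < dim_col (r_fib_mat r n * companion r X)"
  then have i: "i < r" and j: "j < r"
    by (simp_all add: r_fib_mat_def companion_def)
  have prod: "(r_fib_mat r n * companion r X) $$ (i, j)
      = (\<Sum>k<r. r_fib r (n + 1 + k - (r + i)) *
          (if j = r - 1 then X (r - k) else if k = j + 1 then 1 else 0))"
    using i j
    by (simp add: scalar_prod_def r_fib_mat_def companion_def lessThan_atLeast0)
  show "r_fib_mat r (Suc n) $$ (i, j) = (r_fib_mat r n * companion r X) $$ (i, j)"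
  proof (cases "j = r - 1")
    case True
    have "r_fib_mat r (Suc n) $$ (i, j) = r_fib r (n + 1 - i)"
      using i j True by (simp add: r_fib_mat_def)
    \<comment> \<open>The recurrence applies since n >= 2r - 2 and i <= r - 1 give n + 1 - i >= r,
      with equality possible.\<close>
    also have "\<dots> = (\<Sum>k = 1..r. X k * r_fib r (n + 1 - i - k))"
      using assms i by (intro r_fib_rec) auto
    also have "\<dots> = (\<Sum>k<r. r_fib r (n + 1 + k - (r + i)) * X (r - k))"
      by (rule sum.reindex_bij_witness[of _ "\<lambda>k. r - k" "\<lambda>k. r - k"])
        (auto simp: mult.commute intro!: arg_cong[of _ _ "r_fib r"])
    finally show ?thesis
      unfolding prod using True by simp
  next
    case False
    then have "j + 1 < r"
      using j by simp
    \<comment> \<open>Column j of the companion matrix is a unit vector, which picks out the old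
      column j + 1.\<close>
    then have "(r_fib_mat r n * companion r X) $$ (i, j) = r_fib r (n + 1 + (j + 1) - (r + i))"
      unfolding prod by (subst sum.remove[of _ "j + 1"]) (auto intro!: sum.neutral)
    then show ?thesis
      using i j by (simp add: r_fib_mat_def)
  qed
qed (simp_all add: r_fib_mat_def companion_def)

theorem theorem2p6:
  fixes r n :: nat
  assumes "r \<ge> 1" and "n \<ge> 2 * r - 2"
  shows "det (r_fib_mat r n) = (- 1) ^ (n * (r + 1)) * X r ^ (n - (2 * r - 2))"
  using assms(2)
proof (induction n rule: dec_induct)
  case base
  \<comment> \<open>At n = 2r - 2 the claimed sign must be 1, and the exponent of \<open>X r\<close>
    is 0.\<close>
  have "even ((2 * r - 2) * (r + 1))"
    by simp
  then show ?case
    using det_r_fib_mat_initial[OF assms(1)] by (simp only: uminus_power_if) simp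
next
  case (step n)
  have "det (r_fib_mat r (Suc n)) = det (r_fib_mat r n) * ((- 1) ^ (r + 1) * X r)"
    using step.hyps assms(1)
    by (simp add: r_fib_mat_Suc det_mult[OF r_fib_mat_carrier companion_carrier] det_companion)
  also have "\<dots> = (- 1) ^ (n * (r + 1) + (r + 1)) * X r ^ Suc (n - (2 * r - 2))"
    by (simp only: step.IH power_add power_Suc mult_ac)
  also have "n * (r + 1) + (r + 1) = Suc n * (r + 1)"
    by simp
  also have "Suc (n - (2 * r - 2)) = Suc n - (2 * r - 2)"
    using step.hyps by simp
  finally show ?case .
qed

end
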